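(* Let $\mathbb{F}_q$ be a finite field of characteristic $p$ and $n$ a positive integer. (1) If $n$ is odd and $q\geq 8$, then \[ \mathrm{CN}_q(n)\geq q^n\left(\frac{2}{q+1}-\frac{1.45\cdot n}{q^2(q+1)}\right). \] (2) If $n$ is even, $q\geq 9$ and $q-1\nmid n$, then \[ \mathrm{CN}_q(n)\geq q^n\left(\frac12+\frac{1}{q+1}-\frac{0.86\cdot n}{q^2}\right). \]
   Context: For a divisor $l$ of $n$, $x\in\mathbb{F}_{q^n}$ is normal over $\mathbb{F}_{q^l}$ if $\{x, x^{q^l},\ldots,x^{q^{l(n/l-1)}}\}$ is an $\mathbb{F}_{q^l}$-basis of $\mathbb{F}_{q^n}$; $x$ is completely normal over $\mathbb{F}_q$ if it is normal over $\mathbb{F}_{q^l}$ for every positive divisor $l$ of $n$. $\mathrm{CN}_q(n)$ denotes the number of elements of $\mathbb{F}_{q^n}$ that are completely normal over $\mathbb{F}_q$. *)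

theory Defs
  imports Complex_Main "HOL-Library.Cardinality" "HOL-Computational_Algebra.Computational_Algebra"
begin

text \<open>
  The field with \<open>q ^ n\<close> elements is modelled by a type \<open>'a\<close> of class \<^class>\<open>finite_field\<close> with
  \<open>CARD('a) = q ^ n\<close>. For \<open>l dvd n\<close> it has exactly one subfield with \<open>q ^ l\<close> elements
  (\<open>ex1_subfield_of_order\<close> below), so the definite description is well-defined there.
\<close>

definition is_subfield :: "'a::field set \<Rightarrow> bool" where
  "is_subfield K \<longleftrightarrow> 0 \<in> K \<and> 1 \<in> K \<and>
     (\<forall>x\<in>K. \<forall>y\<in>K. x + y \<in> K \<and> x * y \<in> K) \<and>
     (\<forall>x\<in>K. - x \<in> K \<and> inverse x \<in> K)"

definition subfield_of_order :: "nat \<Rightarrow> 'a::field set" where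
  "subfield_of_order m = (THE K. is_subfield K \<and> card K = m)"

definition is_basis_over :: "'a::field set \<Rightarrow> 'a set \<Rightarrow> bool" where
  "is_basis_over K B \<longleftrightarrow> finite B \<and>
     (\<forall>c. (\<forall>b\<in>B. c b \<in> K) \<and> (\<Sum>b\<in>B. c b * b) = 0 \<longrightarrow> (\<forall>b\<in>B. c b = 0)) \<and>
     (\<forall>y. \<exists>c. (\<forall>b\<in>B. c b \<in> K) \<and> (\<Sum>b\<in>B. c b * b) = y)"

definition normal_over :: "nat \<Rightarrow> nat \<Rightarrow> nat \<Rightarrow> 'a::finite_field \<Rightarrow> bool" where
  "normal_over q n l x \<longleftrightarrow>
     is_basis_over (subfield_of_order (q ^ l)) ((\<lambda>i. x ^ (q ^ (l * i))) ` {..<n div l})"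

definition completely_normal :: "nat \<Rightarrow> nat \<Rightarrow> 'a::finite_field \<Rightarrow> bool" where
  "completely_normal q n x \<longleftrightarrow> (\<forall>l. l > 0 \<and> l dvd n \<longrightarrow> normal_over q n l x)"

definition CN :: "'a::finite_field itself \<Rightarrow> nat \<Rightarrow> nat \<Rightarrow> nat" where
  "CN _ q n = card {x :: 'a. completely_normal q n x}"

lemma is_subfield_power_card:
  fixes K :: "'a::finite_field set"
  assumes K: "is_subfield K" and x: "x \<in> K"
  shows "x ^ card K = x"
proof (cases "x = 0")
  case True
  have "card K \<noteq> 0" using x by (auto simp: card_eq_0_iff)
  then show ?thesis using True by (simp add: power_0_left)
next
  case False
  let ?U = "K - {0}"
  have bij: "bij_betw (\<lambda>y. x * y) ?U ?U"
    by (rule bij_betw_byWitness[where f' = "\<lambda>y. inverse x * y"])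
       (use False x K in \<open>auto simp: is_subfield_def mult.assoc[symmetric]\<close>)
  have "(\<Prod>y\<in>?U. y) = (\<Prod>y\<in>?U. x * y)"
    using prod.reindex_bij_betw[OF bij, of "\<lambda>y. y"] by simp
  also have "\<dots> = x ^ card ?U * (\<Prod>y\<in>?U. y)"
    by (simp add: prod.distrib)
  finally have "x ^ card ?U = 1" by (simp add: prod_zero_iff)
  moreover have "card K = Suc (card ?U)"
    using K by (metis card.remove finite is_subfield_def)
  ultimately show ?thesis by simp
qed

lemma card_power_fixed_le:
  assumes "Q > 1"
  shows "card {x :: 'a::finite_field. x ^ Q = x} \<le> Q"
proof -
  let ?p = "monom 1 Q - monom 1 1 :: 'a poly"
  have d: "degree ?p = Q"
    using assms degree_add_eq_left[of "- monom 1 1" "monom 1 Q :: 'a poly"]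
    by (simp add: degree_monom_eq)
  have "?p \<noteq> 0" using d assms by auto
  then have "card {x. poly ?p x = 0} \<le> degree ?p" by (rule card_poly_roots_bound)
  then show ?thesis unfolding d by (simp add: poly_monom)
qed

lemma ex1_subfield_of_order:
  fixes p k q n l :: nat
  assumes p: "CHAR('a::finite_field) = p" and k: "k > 0" and q: "q = p ^ k"
    and n: "n > 0" and card: "CARD('a) = q ^ n" and l: "l > 0" "l dvd n"
  shows "is_subfield {x :: 'a. x ^ (q ^ l) = x} \<and> card {x :: 'a. x ^ (q ^ l) = x} = q ^ l"
    and "\<exists>!K :: 'a set. is_subfield K \<and> card K = q ^ l"
    and "subfield_of_order (q ^ l) = {x :: 'a. x ^ (q ^ l) = x}"
proof -
  define Q where "Q = q ^ l"
  let ?F = "{x :: 'a. x ^ Q = x}"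
  have prime: "prime p" using p by auto
  have q1: "q > 1" unfolding q using k prime prime_gt_1_nat one_less_power by blast
  have Q1: "Q > 1" unfolding Q_def using l q1 one_less_power by blast
  have Qp: "Q = CHAR('a) ^ (k * l)" by (simp add: Q_def q p power_mult)
  have add: "(x + y) ^ Q = x ^ Q + y ^ Q" for x y :: 'a
    using prime p by (intro freshmans_dream'[OF _ Qp]) simp
  have minus: "(- x) ^ Q = - (x ^ Q)" for x :: 'a
    using add[of x "- x"] Q1 by (simp add: power_0_left eq_neg_iff_add_eq_0 add.commute)
  have sub: "is_subfield ?F"
    using Q1 by (auto simp: is_subfield_def add minus power_mult_distrib power_inverse)
  obtain m where m: "n = l * m" using l by auto
  define N where "N = q ^ n - 1"
  have "Q - 1 dvd N"
  proof -
    have "int Q - 1 dvd int Q ^ m - 1" by (metis dvd_triv_left power_diff_1_eq)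
    moreover have "int (Q - 1) = int Q - 1" using Q1 by simp
    moreover have "int N = int Q ^ m - 1"
      using q1 by (simp add: N_def m Q_def power_mult of_nat_diff)
    ultimately show ?thesis by (metis int_dvd_int_iff)
  qed
  then obtain t where t: "N = (Q - 1) * t" by auto
  have N0: "N > 0" using q1 n one_less_power[of q n] by (simp add: N_def)
  have t0: "t > 0" using N0 t by auto
  let ?S = "\<Sum>j<t. monom (1::'a) ((Q - 1) * j)"
  have c: "coeff ?S 0 = 1"
  proof -
    have "coeff ?S 0 = (\<Sum>j<t. if j = 0 then 1 else 0)"
      using Q1 by (simp add: coeff_sum)
    then show ?thesis using t0 by simp
  qed
  then have S0: "?S \<noteq> 0" by (metis coeff_0 zero_neq_one)
  have "degree ?S \<le> (Q - 1) * (t - 1)"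
    by (intro degree_sum_le) (auto intro!: order.trans[OF degree_monom_le] mult_le_mono)
  with card_poly_roots_bound[OF S0]
  have rS: "card {x. poly ?S x = 0} \<le> (Q - 1) * (t - 1)" by linarith
  have cover: "UNIV \<subseteq> ?F \<union> {x. poly ?S x = 0}"
  proof
    fix x :: 'a
    show "x \<in> ?F \<union> {x. poly ?S x = 0}"
    proof (cases "x = 0")
      case True
      then show ?thesis using Q1 by simp
    next
      case False
      have "x ^ Suc N = x"
        using finite_field_power_card_eq_same[of x] card q1 by (simp add: N_def)
      then have "x ^ N = 1" using False by simp
      then have "(x ^ (Q - 1) - 1) * (\<Sum>j<t. (x ^ (Q - 1)) ^ j) = 0"
        using power_diff_1_eq[of "x ^ (Q - 1)" t] t by (simp add: power_mult)
      moreover have "poly ?S x = (\<Sum>j<t. (x ^ (Q - 1)) ^ j)"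
        by (simp add: poly_sum poly_monom power_mult)
      moreover have "x ^ Q = x" if "x ^ (Q - 1) = 1"
        using that Q1 power_minus_mult[of Q x] by simp
      ultimately show ?thesis by auto
    qed
  qed
  have "CARD('a) \<le> card ?F + card {x. poly ?S x = 0}"
    using card_mono[OF _ cover] card_Un_le[of ?F "{x. poly ?S x = 0}"] by simp
  moreover have "CARD('a) = Suc ((Q - 1) * t)" using N0 card unfolding t[symmetric] N_def by linarith
  moreover have "(Q - 1) * t = (Q - 1) * (t - 1) + (Q - 1)"
    using t0 by (cases t) auto
  ultimately have "Q \<le> card ?F" using rS Q1 by linarith
  with card_power_fixed_le[OF Q1] have cF: "card ?F = Q" by (rule order.antisym)
  show 1: "is_subfield {x :: 'a. x ^ (q ^ l) = x} \<and> card {x :: 'a. x ^ (q ^ l) = x} = q ^ l"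
    using sub cF by (simp add: Q_def)
  have uniq: "K = ?F" if "is_subfield K" "card K = q ^ l" for K :: "'a set"
  proof (rule card_subset_eq)
    show "K \<subseteq> ?F" using is_subfield_power_card[OF that(1)] that(2) by (auto simp: Q_def)
    show "card K = card ?F" using that cF by (simp add: Q_def)
  qed simp
  show "\<exists>!K :: 'a set. is_subfield K \<and> card K = q ^ l"
    using 1 uniq by (metis Q_def)
  show "subfield_of_order (q ^ l) = {x :: 'a. x ^ (q ^ l) = x}"
    unfolding subfield_of_order_def using 1 uniq by (intro the_equality) (auto simp: Q_def)
qed

end

theory Submission
  imports Defs "HOL-Analysis.Complex_Transcendental"
begin

text \<open>
  Let \<open>Q = q ^ l\<close> and \<open>m = n div l\<close>. Polynomials over the field with \<open>Q\<close> elements act on \<open>'a\<close>, with \<open>X\<close>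
  acting as \<open>x \<mapsto> x ^ Q\<close>, and \<open>N = X ^ m - 1\<close> acts as zero. An element is normal as soon as none of
  the \<open>N / f\<close> annihilates it, \<open>f\<close> running over the monic irreducible factors of \<open>N\<close>. A divisor \<open>D\<close>
  of \<open>N\<close> has a kernel of size \<open>Q ^ degree D\<close>, so by coprimality these conditions are independent and
  a proportion of exactly \<open>\<Prod>f. 1 - Q ^ (- degree f)\<close> of the elements satisfies all of them.

  For \<open>l \<ge> 2\<close> the proportion of exceptions is at most \<open>n / (l q ^ l)\<close>. For \<open>l = 1\<close>, with \<open>a\<close> linear factors,
  the product is at least \<open>(1 - 1/q) ^ a (1 - n / (2 q\<^sup>2))\<close>; here \<open>a \<le> q - 1\<close>, and
  \<open>a \<le> (q - 1) / 2\<close> if \<open>q - 1\<close> does not divide \<open>n\<close>, while \<open>(1 - 1/q) ^ (q - 1) \<ge> 1 / e \<ge> 9 / 25\<close>. A union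
  bound over the divisors \<open>l\<close> of \<open>n\<close>, where \<open>l = 2\<close> does not occur for odd \<open>n\<close>, yields the estimates.
\<close>

section \<open>Independent events and product bounds\<close>

text \<open>Inclusion-exclusion, one condition at a time: avoiding \<open>S j\<close> removes the
  elements for which \<open>j\<close> has moved from \<open>H\<close> to \<open>T\<close>. Hence
  \<open>T\<close> must vary in the induction. The case of empty \<open>T\<close> in
  \<open>indep\<close> shows that \<open>C\<close> is the size of the whole type.\<close>

lemma card_avoid_independent:
  fixes S :: "'i \<Rightarrow> 'b::finite set" and p :: "'i \<Rightarrow> real"
  assumes indep: "\<And>T. T \<subseteq> I \<Longrightarrow> real (card {x. \<forall>i\<in>T. x \<in> S i}) = C * (\<Prod>i\<in>T. p i)"
    and fin: "finite I" and "H \<subseteq> I" "T \<subseteq> I" "H \<inter> T = {}"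
  shows "real (card {x. (\<forall>i\<in>T. x \<in> S i) \<and> (\<forall>i\<in>H. x \<notin> S i)})
           = C * (\<Prod>i\<in>T. p i) * (\<Prod>i\<in>H. 1 - p i)"
proof -
  have "finite H" using assms finite_subset by blast
  then show ?thesis using assms(3-5)
  proof (induction H arbitrary: T rule: finite_induct)
    case empty
    then show ?case using indep by simp
  next
    case (insert j H)
    let ?A = "\<lambda>T H. {x. (\<forall>i\<in>T. x \<in> S i) \<and> (\<forall>i\<in>H. x \<notin> S i)}"
    have finT: "finite T" using insert.prems fin finite_subset by blast
    have split: "?A T H = ?A T (insert j H) \<union> ?A (insert j T) H" by auto
    have "card (?A T H) = card (?A T (insert j H)) + card (?A (insert j T) H)"
      unfolding split by (rule card_Un_disjoint) auto
    then have "real (card (?A T (insert j H))) = real (card (?A T H)) - real (card (?A (insert j T) H))"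
      by simp
    also have "\<dots> = C * (\<Prod>i\<in>T. p i) * (\<Prod>i\<in>H. 1 - p i)
        - C * (\<Prod>i\<in>insert j T. p i) * (\<Prod>i\<in>H. 1 - p i)"
      using insert.IH[of T] insert.IH[of "insert j T"] insert.prems insert.hyps by auto
    also have "\<dots> = C * (\<Prod>i\<in>T. p i) * (\<Prod>i\<in>insert j H. 1 - p i)"
      using insert.prems insert.hyps finT by (simp add: algebra_simps)
    finally show ?case .
  qed
qed

text \<open>The Weierstrass product inequality.\<close>

lemma prod_one_minus_ge:
  fixes p :: "'i \<Rightarrow> real"
  assumes "finite A" "\<And>i. i \<in> A \<Longrightarrow> 0 \<le> p i \<and> p i \<le> 1"
  shows "1 - (\<Sum>i\<in>A. p i) \<le> (\<Prod>i\<in>A. 1 - p i)"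
  using assms
proof (induction A rule: finite_induct)
  case empty
  then show ?case by simp
next
  case (insert j A)
  have P: "0 \<le> (\<Prod>i\<in>A. 1 - p i)" "(\<Prod>i\<in>A. 1 - p i) \<le> 1"
    using insert.prems by (auto intro!: prod_nonneg prod_le_1)
  have "p j * (\<Prod>i\<in>A. 1 - p i) \<le> p j" using P insert.prems by (simp add: mult_left_le)
  then show ?case using insert by (simp add: algebra_simps)
qed

section \<open>The polynomial ring over the subfield of order \<open>Q\<close>\<close>

text \<open>The exponent \<open>e\<close> makes \<open>Q\<close> a power of the characteristic, so
  that raising to the power \<open>Q\<close> is additive.\<close>

locale frobenius_module =
  fixes field_type :: "'a::finite_field itself" and Q m e :: nat
  assumes Q_eq: "Q = CHAR('a) ^ e" and Q_gt_1: "Q > 1"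
    and card_UNIV: "CARD('a) = Q ^ m" and m_pos: "m > 0"
begin

definition K :: "'a set" where "K = {x. x ^ Q = x}"

definition frob :: "'a poly \<Rightarrow> 'a poly" where "frob = map_poly (\<lambda>c. c ^ Q)"

text \<open>\<open>R\<close> plays the role of \<open>K[X]\<close>, realised inside \<open>'a poly\<close> as the fixed ring of \<^term>\<open>frob\<close>.\<close>

definition R :: "'a poly set" where "R = {f. frob f = f}"

text \<open>Evaluation at \<open>x\<close> of the linearized polynomial associated with
  \<open>f\<close>.\<close>

definition act :: "'a poly \<Rightarrow> 'a \<Rightarrow> 'a" where
  "act f x = (\<Sum>i\<le>degree f. coeff f i * x ^ (Q ^ i))"

definition N :: "'a poly" where "N = monom 1 m - 1"

lemma prime_char: "prime CHAR('a)" by auto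

lemma power_Q_add: "(x + y :: 'a) ^ Q = x ^ Q + y ^ Q"
  by (rule freshmans_dream'[OF prime_char Q_eq])

lemma power_Q_sum: "sum g A ^ Q = (\<Sum>i\<in>A. (g i :: 'a) ^ Q)"
  by (rule freshmans_dream_sum'[OF prime_char Q_eq])

lemma power_Q_minus: "(- x :: 'a) ^ Q = - (x ^ Q)"
  using power_Q_add[of x "- x"] Q_gt_1 by (simp add: power_0_left eq_neg_iff_add_eq_0 add.commute)

lemma power_Q_diff: "(x - y :: 'a) ^ Q = x ^ Q - y ^ Q"
  using power_Q_add[of x "- y"] by (simp add: power_Q_minus)

lemma coeff_frob: "coeff (frob f) i = coeff f i ^ Q"
  unfolding frob_def using Q_gt_1 by (subst coeff_map_poly) auto

lemma frob_mult: "frob (f * g) = frob f * frob g"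
  by (rule poly_eqI) (simp add: coeff_frob coeff_mult power_Q_sum power_mult_distrib)

lemma frob_add: "frob (f + g) = frob f + frob g"
  by (rule poly_eqI) (simp add: coeff_frob power_Q_add)

lemma frob_diff: "frob (f - g) = frob f - frob g"
  by (rule poly_eqI) (simp add: coeff_frob power_Q_diff)

lemma degree_frob: "degree (frob f) = degree f"
  unfolding frob_def using Q_gt_1 by (intro degree_map_poly) auto

lemma frob_eq_0_iff: "frob f = 0 \<longleftrightarrow> f = 0"
  using Q_gt_1 by (simp add: poly_eq_iff coeff_frob)

lemma R_iff: "f \<in> R \<longleftrightarrow> (\<forall>i. coeff f i \<in> K)"
  by (simp add: R_def K_def poly_eq_iff coeff_frob)

lemma K_0 [simp]: "0 \<in> K" and K_1 [simp]: "1 \<in> K"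
  using Q_gt_1 by (auto simp: K_def)

lemma R_add [intro]: "f \<in> R \<Longrightarrow> g \<in> R \<Longrightarrow> f + g \<in> R"
  and R_diff [intro]: "f \<in> R \<Longrightarrow> g \<in> R \<Longrightarrow> f - g \<in> R"
  and R_mult [intro]: "f \<in> R \<Longrightarrow> g \<in> R \<Longrightarrow> f * g \<in> R"
  by (auto simp: R_def frob_add frob_diff frob_mult)

lemma R_monom: "c \<in> K \<Longrightarrow> monom c i \<in> R"
  by (auto simp: R_iff)

lemma R_0 [simp]: "0 \<in> R" and R_1 [simp]: "1 \<in> R"
  using R_monom[of 0 0] R_monom[of 1 0] by (simp_all add: monom_0 one_pCons)

lemma R_smult: "c \<in> K \<Longrightarrow> f \<in> R \<Longrightarrow> smult c f \<in> R"
  by (auto simp: R_iff K_def power_mult_distrib)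

lemma R_prod: "(\<And>i. i \<in> A \<Longrightarrow> g i \<in> R) \<Longrightarrow> prod g A \<in> R"
  by (induction A rule: infinite_finite_induct) auto

lemma R_N [simp]: "N \<in> R"
  unfolding N_def by (intro R_diff R_monom) auto

text \<open>Uniqueness of quotient and remainder makes both invariant under \<^term>\<open>frob\<close>.\<close>

lemma R_div_mod:
  assumes f: "f \<in> R" and g: "g \<in> R" and g0: "g \<noteq> 0"
  shows "f div g \<in> R" "f mod g \<in> R"
proof -
  have eq: "f = g * (f div g) + f mod g" by simp
  have "frob f = frob g * frob (f div g) + frob (f mod g)"
    by (subst eq, subst frob_add, subst frob_mult, rule refl)
  then have "f = g * frob (f div g) + frob (f mod g)" using f g by (simp add: R_def)
  with eq have diff: "g * (frob (f div g) - f div g) = f mod g - frob (f mod g)"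
    by (simp add: algebra_simps)
  have deg: "f mod g = 0 \<or> degree (f mod g) < degree g" using g0 degree_mod_less by blast
  have "frob (f div g) - f div g = 0"
  proof (rule ccontr)
    assume ne: "frob (f div g) - f div g \<noteq> 0"
    then have "degree g \<le> degree (f mod g - frob (f mod g))"
      unfolding diff[symmetric] using g0 by (simp add: degree_mult_eq)
    moreover have "f mod g - frob (f mod g) \<noteq> 0" using ne g0 diff by (metis mult_eq_0_iff)
    then have "f mod g \<noteq> 0" by (metis diff_self frob_eq_0_iff)
    moreover have "degree (f mod g - frob (f mod g)) \<le> degree (f mod g)"
      by (rule degree_diff_le) (auto simp: degree_frob)
    ultimately show False using deg by auto
  qed
  with diff show "f div g \<in> R" "f mod g \<in> R" by (auto simp: R_def)
qed

lemma R_quotient: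
  assumes "g * h \<in> R" "g \<in> R" "g \<noteq> 0"
  shows "h \<in> R"
  using R_div_mod(1)[OF assms] assms(3) by simp

text \<open>The usual Euclidean argument: an element of least degree generates, since by
  \<open>R_div_mod\<close> the division by it takes place inside \<open>R\<close>.\<close>

lemma ideal_generator:
  assumes sub: "S \<subseteq> R" and diff: "\<And>f g. f \<in> S \<Longrightarrow> g \<in> S \<Longrightarrow> f - g \<in> S"
    and mult: "\<And>f g. f \<in> R \<Longrightarrow> g \<in> S \<Longrightarrow> f * g \<in> S"
    and ne: "f0 \<in> S" "f0 \<noteq> 0"
  obtains d where "d \<in> S" "d \<noteq> 0" "\<And>f. f \<in> S \<Longrightarrow> d dvd f"
proof -
  obtain d where d: "d \<in> S" "d \<noteq> 0" and min: "\<And>f. f \<in> S \<Longrightarrow> f \<noteq> 0 \<Longrightarrow> degree d \<le> degree f"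
    using ne ex_has_least_nat[of "\<lambda>f. f \<in> S \<and> f \<noteq> 0" f0 degree] by auto
  have "d dvd f" if f: "f \<in> S" for f
  proof -
    have "f mod d = f - (f div d) * d" by (simp add: minus_div_mult_eq_mod)
    moreover have "f div d \<in> R" using R_div_mod(1) f d sub by auto
    ultimately have "f mod d \<in> S" using diff mult f d by metis
    then have "f mod d = 0" using min degree_mod_less[OF d(2), of f] by fastforce
    then show ?thesis by (simp add: mod_eq_0_iff_dvd)
  qed
  then show ?thesis using that d by blast
qed

section \<open>The action by linearized polynomials and its kernels\<close>

lemma degree_N: "degree N = m"
  unfolding N_def using m_pos degree_add_eq_left[of "- 1" "monom 1 m :: 'a poly"]
  by (simp add: degree_monom_eq)

lemma N_nonzero: "N \<noteq> 0" using degree_N m_pos by auto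

lemma act_eq_sum: "degree f \<le> d \<Longrightarrow> act f x = (\<Sum>i\<le>d. coeff f i * x ^ (Q ^ i))"
  unfolding act_def by (rule sum.mono_neutral_left) (auto simp: coeff_eq_0)

lemma act_add_left: "act (f + g) x = act f x + act g x"
proof -
  let ?d = "max (degree f) (degree g)"
  have "degree (f + g) \<le> ?d" by (rule degree_add_le) auto
  then show ?thesis
    by (simp add: act_eq_sum[where d = ?d] sum.distrib algebra_simps)
qed

lemma act_0_left [simp]: "act 0 x = 0" by (simp add: act_def)

lemma act_diff_left: "act (f - g) x = act f x - act g x"
  using act_add_left[of "f - g" g x] by (simp add: algebra_simps)

lemma act_smult_left: "act (smult c f) x = c * act f x"
  using act_eq_sum[of "smult c f" "degree f" x]
  by (simp add: act_def sum_distrib_left mult.assoc degree_smult_le)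

lemma act_pCons: "act (pCons c f) x = c * x + act f (x ^ Q)"
proof -
  have "act (pCons c f) x = (\<Sum>i\<le>Suc (degree f). coeff (pCons c f) i * x ^ (Q ^ i))"
    by (rule act_eq_sum) (simp add: degree_pCons_le)
  also have "\<dots> = c * x + (\<Sum>i\<le>degree f. coeff f i * x ^ (Q ^ Suc i))"
    by (subst sum.atMost_Suc_shift) simp
  also have "\<dots> = c * x + act f (x ^ Q)"
    by (simp add: act_def power_mult)
  finally show ?thesis .
qed

lemma act_monom: "act (monom c i) x = c * x ^ (Q ^ i)"
proof (induction i arbitrary: x)
  case 0
  then show ?case by (simp add: monom_0 act_pCons)
next
  case (Suc i)
  then show ?case by (simp add: monom_Suc act_pCons power_mult)
qed

lemma power_Q_power_add: "(x + y :: 'a) ^ (Q ^ i) = x ^ (Q ^ i) + y ^ (Q ^ i)"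
  by (rule freshmans_dream'[OF prime_char, where n = "e * i"]) (simp add: Q_eq power_mult)

lemma act_add_right: "act f (x + y) = act f x + act f y"
  by (simp add: act_def power_Q_power_add distrib_left sum.distrib)

lemma act_diff_right: "act f (x - y) = act f x - act f y"
  using act_add_right[of f "x - y" y] by simp

lemma act_0_right [simp]: "act f 0 = 0"
  using act_diff_right[of f 0 0] by simp

lemma act_power_Q:
  assumes "g \<in> R"
  shows "act g (x ^ Q) = act g x ^ Q"
  using assms by (simp add: act_def R_iff K_def power_Q_sum power_mult_distrib mult.commute flip: power_mult)

text \<open>Composition is noncommutative in general; it agrees with the product here because the
  coefficients of \<open>g\<close> are fixed by the power \<open>Q\<close>, so \<open>act g\<close>
  commutes with it. No such condition on \<open>f\<close> is involved.\<close>

lemma act_mult: "g \<in> R \<Longrightarrow> act (f * g) x = act f (act g x)"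
proof (induction f arbitrary: x)
  case 0
  then show ?case by simp
next
  case (pCons c f)
  then show ?case
    by (simp add: act_add_left act_smult_left act_pCons act_power_Q)
qed

lemma act_N: "act N x = 0"
proof -
  have "act N x = x ^ CARD('a) - x"
    unfolding N_def by (simp add: act_diff_left act_monom card_UNIV one_pCons act_pCons del: monom_eq_1_iff)
  then show ?thesis by (simp add: finite_field_power_card_eq_same)
qed

text \<open>The kernel is the root set of the linearized polynomial of \<open>f\<close>, whose
  degree is at most \<open>Q ^ degree f\<close>.\<close>

lemma card_ker_le:
  assumes "f \<noteq> 0"
  shows "card {x. act f x = 0} \<le> Q ^ degree f"
proof -
  let ?L = "\<Sum>i\<le>degree f. monom (coeff f i) (Q ^ i)"
  \<comment> \<open>The exponents \<open>Q ^ i\<close> are distinct, so the top coefficient survives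
    and \<open>?L\<close> is nonzero.\<close>
  have "coeff ?L (Q ^ degree f) = (\<Sum>i\<le>degree f. if i = degree f then coeff f i else 0)"
    unfolding coeff_sum using Q_gt_1 by (intro sum.cong) auto
  then have "coeff ?L (Q ^ degree f) = lead_coeff f" by simp
  then have L0: "?L \<noteq> 0" using assms by (metis coeff_0 leading_coeff_0_iff)
  have "degree ?L \<le> Q ^ degree f"
    using Q_gt_1 by (intro degree_sum_le) (auto intro!: order.trans[OF degree_monom_le] power_increasing)
  moreover have "poly ?L x = act f x" for x
    by (simp add: act_def poly_sum poly_monom)
  ultimately show ?thesis using card_poly_roots_bound[OF L0] by simp
qed

text \<open>For \<open>N = D E\<close> the image of \<open>D\<close> lies in the kernel of \<open>E\<close>, so both upper bounds on the
  kernels must be attained.\<close>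

lemma card_ker_eq:
  assumes D: "D \<in> R" "D dvd N"
  shows "card {x. act D x = 0} = Q ^ degree D"
proof -
  obtain E where E: "N = D * E" using D by auto
  have D0: "D \<noteq> 0" and E0: "E \<noteq> 0" using E N_nonzero by auto
  have ER: "E \<in> R" using R_quotient[of D E] R_N D D0 E by simp
  let ?kD = "{x. act D x = 0}" and ?kE = "{x. act E x = 0}"
  \<comment> \<open>A nonempty fibre is a translate of the kernel.\<close>
  have fib: "card {x. act D x = y} \<le> card ?kD" for y
  proof (cases "\<exists>x0. act D x0 = y")
    case True
    then obtain x0 where x0: "act D x0 = y" by blast
    show ?thesis
      by (rule card_inj_on_le[where f = "\<lambda>x. x - x0"]) (auto simp: inj_on_def act_diff_right x0)
  next
    case False
    then have "{x. act D x = y} = {}" by auto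
    then show ?thesis by simp
  qed
  have "act E (act D x) = 0" for x
    using act_mult[OF D(1), of E x] act_N E by (simp add: mult.commute)
  then have "UNIV = (\<Union>y\<in>?kE. {x. act D x = y})" by auto
  then have "CARD('a) \<le> (\<Sum>y\<in>?kE. card {x. act D x = y})"
    by (metis card_UN_le finite)
  also have "\<dots> \<le> card ?kE * card ?kD"
    using sum_bounded_above[of ?kE "\<lambda>y. card {x. act D x = y}" "card ?kD"] fib by simp
  also have "\<dots> \<le> Q ^ degree E * card ?kD"
    using card_ker_le[OF E0] by simp
  finally have "Q ^ degree E * Q ^ degree D \<le> Q ^ degree E * card ?kD"
    using D0 E0 degree_N by (simp add: card_UNIV E degree_mult_eq add.commute flip: power_add)
  then have "Q ^ degree D \<le> card ?kD" using Q_gt_1 by (subst (asm) mult_le_cancel1) simp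
  then show ?thesis using card_ker_le[OF D0] by simp
qed

section \<open>Monic irreducibles and coprimality\<close>

text \<open>Here \<open>dvd\<close> refers to \<open>'a poly\<close>, but for nonzero divisors in
  \<open>R\<close> it agrees with divisibility inside \<open>R\<close>, by
  \<open>R_quotient\<close>.\<close>

definition irred :: "'a poly set" where
  "irred = {f \<in> R. lead_coeff f = 1 \<and> degree f > 0 \<and>
     (\<forall>g\<in>R. g dvd f \<longrightarrow> degree g = 0 \<or> degree g = degree f)}"

definition I :: "'a poly set" where "I = {f \<in> irred. f dvd N}"

text \<open>The Bezout form can be applied directly to elements through \<open>act\<close>.\<close>

definition R_coprime :: "'a poly \<Rightarrow> 'a poly \<Rightarrow> bool" where
  "R_coprime f g \<longleftrightarrow> (\<exists>u\<in>R. \<exists>v\<in>R. u * f + v * g = 1)"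

lemma K_inverse: "c \<in> K \<Longrightarrow> inverse c \<in> K"
  by (simp add: K_def power_inverse)

lemma dvd_monic_same_degree:
  assumes "f dvd g" "degree f = degree g" "lead_coeff f = 1" "lead_coeff g = (1::'a)"
  shows "f = g"
proof -
  obtain h where h: "g = f * h" using assms(1) by auto
  have "g \<noteq> 0" using assms(4) by auto
  then have "f \<noteq> 0" "h \<noteq> 0" using h by auto
  then have "degree h = 0" using assms(2) h by (simp add: degree_mult_eq)
  then obtain c where c: "h = [:c:]" by (metis degree_eq_zeroE)
  have "lead_coeff g = lead_coeff f * lead_coeff h" by (simp add: h lead_coeff_mult)
  then have "c = 1" using assms c by simp
  then show ?thesis using h c by (simp add: one_pCons)
qed

text \<open>Take a nonconstant divisor in \<open>R\<close> of least degree and make it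
  monic.\<close>

lemma ex_irred_dvd:
  assumes D: "D \<in> R" "degree D > 0"
  obtains f where "f \<in> irred" "f dvd D"
proof -
  let ?P = "\<lambda>f. f \<in> R \<and> f dvd D \<and> degree f > 0"
  obtain f where f: "?P f" and min: "\<And>g. ?P g \<Longrightarrow> degree f \<le> degree g"
    using D ex_has_least_nat[of ?P D degree] by auto
  have f0: "f \<noteq> 0" using f by auto
  let ?c = "inverse (lead_coeff f)"
  let ?g = "smult ?c f"
  have c0: "?c \<noteq> 0" using f0 by simp
  have "?g \<in> R" using f by (intro R_smult K_inverse) (auto simp: R_iff)
  moreover have "degree g = 0 \<or> degree g = degree ?g" if "g \<in> R" "g dvd ?g" for g
  proof -
    have gf: "g dvd f" using that c0 dvd_smult_cancel by blast
    then have "degree g \<le> degree f" using f0 by (simp add: dvd_imp_degree_le)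
    moreover have "degree f \<le> degree g" if "degree g > 0"
      using min[of g] gf f that \<open>g \<in> R\<close> dvd_trans by blast
    ultimately show ?thesis using c0 by fastforce
  qed
  ultimately have "?g \<in> irred" using f f0 by (auto simp: irred_def)
  moreover have "?g dvd D" using f c0 by (simp add: smult_dvd_iff)
  ultimately show ?thesis using that by blast
qed

text \<open>A generator of the ideal spanned by \<open>f\<close> and \<open>g\<close> divides both.
  If it were nonconstant, its monic multiple would equal \<open>f\<close> as well as
  \<open>g\<close>.\<close>

lemma irred_coprime:
  assumes f: "f \<in> irred" and g: "g \<in> irred" and "f \<noteq> g"
  shows "R_coprime f g"
proof -
  have fR: "f \<in> R" and gR: "g \<in> R" and f0: "f \<noteq> 0" and g0: "g \<noteq> 0"
    using f g by (auto simp: irred_def)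
  let ?S = "{h. \<exists>u\<in>R. \<exists>v\<in>R. h = u * f + v * g}"
  obtain d where d: "d \<in> ?S" "d \<noteq> 0" "\<And>h. h \<in> ?S \<Longrightarrow> d dvd h"
  proof (rule ideal_generator[of ?S f])
    show "?S \<subseteq> R" using fR gR by blast
    show "h - k \<in> ?S" if "h \<in> ?S" "k \<in> ?S" for h k
    proof -
      from that obtain u v u' v' where "u \<in> R" "v \<in> R" "u' \<in> R" "v' \<in> R"
        "h = u * f + v * g" "k = u' * f + v' * g" by blast
      then show ?thesis
        by (intro CollectI bexI[of _ "u - u'"] bexI[of _ "v - v'"]) (auto simp: algebra_simps)
    qed
    show "h * k \<in> ?S" if "h \<in> R" "k \<in> ?S" for h k
    proof -
      from that obtain u v where "u \<in> R" "v \<in> R" "k = u * f + v * g" by blast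
      then show ?thesis using that(1)
        by (intro CollectI bexI[of _ "h * u"] bexI[of _ "h * v"]) (auto simp: algebra_simps)
    qed
    show "f \<in> ?S" by (intro CollectI bexI[of _ 1] bexI[of _ 0]) auto
  qed (use f0 in auto)
  have "f \<in> ?S" by (intro CollectI bexI[of _ 1] bexI[of _ 0]) auto
  then have df: "d dvd f" using d by blast
  have "g \<in> ?S" by (intro CollectI bexI[of _ 0] bexI[of _ 1]) auto
  then have dg: "d dvd g" using d by blast
  have dR: "d \<in> R" using d(1) fR gR by blast
  let ?c = "inverse (lead_coeff d)"
  have c: "?c \<noteq> 0" "?c \<in> K" using d(2) dR by (auto intro!: K_inverse simp: R_iff)
  have "degree d = 0"
  proof (rule ccontr)
    assume "degree d \<noteq> 0"
    then have deg: "degree d = degree f" "degree d = degree g"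
      using f g df dg dR by (auto simp: irred_def)
    have "smult ?c d = f" "smult ?c d = g"
      using df dg deg f g c d(2)
      by (auto intro!: dvd_monic_same_degree simp: smult_dvd_iff irred_def)
    then show False using \<open>f \<noteq> g\<close> by simp
  qed
  then obtain a where a: "d = [:a:]" by (metis degree_eq_zeroE)
  then have one: "smult ?c d = 1" using d(2) by (simp add: one_pCons)
  from d(1) obtain u v where uv: "u \<in> R" "v \<in> R" "d = u * f + v * g" by blast
  have "smult ?c u * f + smult ?c v * g = 1"
    using one uv(3) by (simp add: smult_add_right)
  then show ?thesis unfolding R_coprime_def using uv c R_smult by blast
qed

text \<open>Multiply the two Bezout identities.\<close>

lemma R_coprime_mult:
  assumes fR: "f \<in> R" "g \<in> R" and c: "R_coprime f g" "R_coprime f h" "h \<in> R"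
  shows "R_coprime f (g * h)"
proof -
  from c obtain u v u' v' where uv: "u \<in> R" "v \<in> R" "u' \<in> R" "v' \<in> R"
    "u * f + v * g = 1" "u' * f + v' * h = 1" unfolding R_coprime_def by blast
  have "(u * u' * f + u * v' * h + v * g * u') * f + (v * v') * (g * h)
      = (u * f + v * g) * (u' * f + v' * h)" by (simp add: algebra_simps)
  also have "\<dots> = 1" using uv by simp
  finally show ?thesis unfolding R_coprime_def
    using uv fR c by (intro bexI[of _ "u * u' * f + u * v' * h + v * g * u'"] bexI[of _ "v * v'"]) auto
qed

lemma R_coprime_prod:
  assumes "finite T" "f \<in> R" "\<And>g. g \<in> T \<Longrightarrow> g \<in> R \<and> R_coprime f g"
  shows "R_coprime f (\<Prod>T)"
  using assms
proof (induction T rule: finite_induct)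
  case empty
  show ?case unfolding R_coprime_def by (intro bexI[of _ 0] bexI[of _ 1]) auto
next
  case (insert g T)
  then show ?case by (auto intro!: R_coprime_mult R_prod)
qed

section \<open>Irreducible factors of \<open>N\<close> and the exact count\<close>

lemma I_R: "f \<in> I \<Longrightarrow> f \<in> R" and I_nonzero: "f \<in> I \<Longrightarrow> f \<noteq> 0"
  and I_dvd: "f \<in> I \<Longrightarrow> f dvd N" and I_degree: "f \<in> I \<Longrightarrow> degree f > 0"
  by (auto simp: I_def irred_def)

text \<open>Joint annihilation is reduced to one kernel, whose size is known. With \<open>P\<close>
  the product so far, \<open>N = f P W\<close> and \<open>u f + v P = 1\<close>, the identity
  \<open>W = u (f W) + v (P W)\<close> shows that an element killed by \<open>f W\<close> and
  \<open>P W\<close> is killed by \<open>W\<close>.\<close>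

lemma prod_dvd_N_and_ker:
  assumes "finite T" "T \<subseteq> I"
  shows "\<Prod>T dvd N \<and> (\<forall>x. (\<forall>f\<in>T. act (N div f) x = 0) \<longleftrightarrow> act (N div \<Prod>T) x = 0)"
  using assms
proof (induction T rule: finite_induct)
  case empty
  then show ?case by (simp add: act_N)
next
  case (insert f T)
  let ?P = "\<Prod>T"
  have TI: "T \<subseteq> I" and fI: "f \<in> I" using insert.prems by auto
  have IH: "?P dvd N" "\<And>x. (\<forall>f\<in>T. act (N div f) x = 0) \<longleftrightarrow> act (N div ?P) x = 0"
    using insert.IH TI by auto
  have fR: "f \<in> R" and f0: "f \<noteq> 0" using fI I_R I_nonzero by auto
  have PR: "?P \<in> R" using TI I_R by (intro R_prod) auto
  have P0: "?P \<noteq> 0" using IH(1) N_nonzero by auto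
  have "R_coprime f ?P"
    using insert.hyps fI TI fR by (intro R_coprime_prod) (auto intro!: irred_coprime simp: I_R I_def subset_iff)
  then obtain u v where uv: "u \<in> R" "v \<in> R" "u * f + v * ?P = 1"
    unfolding R_coprime_def by blast
  obtain a where a: "N = f * a" using I_dvd[OF fI] by auto
  obtain b where b: "N = ?P * b" using IH(1) by auto
  \<comment> \<open>In each summand \<open>N\<close> is replaced by the factorization containing the
    other factor, so that \<open>f * ?P\<close> splits off.\<close>
  have "N = (u * f + v * ?P) * N" using uv by simp
  also have "\<dots> = (f * ?P) * (u * b + v * a)"
  proof -
    have "u * f * N = u * f * (?P * b)" "v * ?P * N = v * ?P * (f * a)"
      by (simp_all flip: a b)
    then have "(u * f + v * ?P) * N = u * f * (?P * b) + v * ?P * (f * a)"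
      by (simp only: distrib_right)
    also have "\<dots> = (f * ?P) * (u * b + v * a)" by (simp add: algebra_simps)
    finally show ?thesis .
  qed
  finally obtain W where W: "N = (f * ?P) * W" by blast
  have WR: "W \<in> R" using R_quotient[of "f * ?P" W] W R_N f0 P0 fR PR by auto
  have d1: "N div f = ?P * W" using W f0 by (simp add: mult.assoc)
  have d2: "N div ?P = f * W" using W P0 by (simp add: mult.assoc mult.left_commute[of f])
  have d3: "N div (f * ?P) = W" using W f0 P0 by simp
  have "act (?P * W) x = 0 \<and> act (f * W) x = 0 \<longleftrightarrow> act W x = 0" for x
  proof
    assume "act (?P * W) x = 0 \<and> act (f * W) x = 0"
    moreover have "act W x = act ((u * f + v * ?P) * W) x" using uv(3) by simp
    then have "act W x = act u (act (f * W) x) + act v (act (?P * W) x)"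
      by (simp add: distrib_right mult.assoc act_add_left act_mult WR fR PR R_mult)
    ultimately show "act W x = 0" by simp
  qed (simp add: act_mult WR)
  then show ?case
    using insert.hyps IH(2) W d1 d2 d3 by auto
qed

lemma sum_degree_le:
  assumes "finite T" "T \<subseteq> I"
  shows "(\<Sum>f\<in>T. degree f) \<le> m"
proof -
  have "degree (\<Prod>T) \<le> degree N"
    using prod_dvd_N_and_ker[OF assms] N_nonzero by (intro dvd_imp_degree_le) auto
  moreover have "degree (\<Prod>T) = (\<Sum>f\<in>T. degree f)"
    using assms I_nonzero by (intro degree_prod_eq_sum_degree) auto
  ultimately show ?thesis by (simp add: degree_N)
qed

text \<open>Factors have positive degree, so \<open>sum_degree_le\<close> bounds the size of every
  finite subset.\<close>

lemma finite_I: "finite I" and card_I_le: "card I \<le> m"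
proof -
  have "card T \<le> m" if "T \<subseteq> I" "finite T" for T
  proof -
    have "card T * 1 \<le> (\<Sum>f\<in>T. degree f)"
      using sum_bounded_below[of T 1 degree] that I_degree by (force simp: Suc_le_eq)
    then show ?thesis using sum_degree_le that by fastforce
  qed
  then have "finite I \<and> card I \<le> m" by (intro finite_if_finite_subsets_card_bdd) auto
  then show "finite I" "card I \<le> m" by auto
qed

text \<open>The kernel of \<open>N div \<Prod>T\<close> has degree \<open>m\<close> minus the
  degrees in \<open>T\<close> as its exponent of \<open>Q\<close>, which is the independence
  required by \<open>card_avoid_independent\<close>.\<close>

lemma card_avoiding:
  "real (card {x. \<forall>f\<in>I. act (N div f) x \<noteq> 0}) = real Q ^ m * (\<Prod>f\<in>I. 1 - 1 / real Q ^ degree f)"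
proof -
  have "real (card {x. \<forall>f\<in>T. x \<in> {x. act (N div f) x = 0}})
      = real Q ^ m * (\<Prod>f\<in>T. 1 / real Q ^ degree f)" if T: "T \<subseteq> I" for T
  proof -
    have finT: "finite T" using T finite_I finite_subset by blast
    have P: "\<Prod>T dvd N" "{x. \<forall>f\<in>T. act (N div f) x = 0} = {x. act (N div \<Prod>T) x = 0}"
      using prod_dvd_N_and_ker[OF finT T] by auto
    obtain W where W: "N = \<Prod>T * W" using P(1) by auto
    have P0: "\<Prod>T \<noteq> 0" "W \<noteq> 0" using W N_nonzero by auto
    have PR: "\<Prod>T \<in> R" using T I_R by (intro R_prod) auto
    have WR: "W \<in> R" using R_quotient[of "\<Prod>T" W] R_N W P0 PR by simp
    have NW: "N div \<Prod>T = W" using W P0 by simp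
    have "card {x. act W x = 0} = Q ^ degree W"
      using WR W by (intro card_ker_eq) auto
    moreover have "m = degree (\<Prod>T) + degree W"
      using W P0 degree_N degree_mult_eq by metis
    moreover have "degree (\<Prod>T) = (\<Sum>f\<in>T. degree f)"
      using T I_nonzero by (intro degree_prod_eq_sum_degree) auto
    ultimately have "real Q ^ m = (\<Prod>f\<in>T. real Q ^ degree f) * real (card {x. act W x = 0})"
      by (simp add: power_add power_sum)
    moreover have "(\<Prod>f\<in>T. real Q ^ degree f) \<noteq> 0" using Q_gt_1 finT by simp
    ultimately show ?thesis
      by (simp add: P NW prod_dividef)
  qed
  from card_avoid_independent[OF this finite_I, of I "{}"] show ?thesis by simp
qed

section \<open>Normal bases from avoiding elements\<close>

text \<open>The annihilator of \<open>x\<close> in \<open>R\<close> has a generator \<open>d\<close>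
  dividing \<open>N\<close>. If the cofactor were nonconstant, an irreducible factor
  \<open>f\<close> of it would make \<open>N div f\<close> a multiple of \<open>d\<close>, hence an
  annihilator of \<open>x\<close>.\<close>

lemma annihilator_degree:
  assumes x: "\<forall>f\<in>I. act (N div f) x \<noteq> 0" and g: "g \<in> R" "g \<noteq> 0" "act g x = 0"
  shows "degree g \<ge> m"
proof -
  let ?S = "{h \<in> R. act h x = 0}"
  obtain d where d: "d \<in> ?S" "d \<noteq> 0" "\<And>h. h \<in> ?S \<Longrightarrow> d dvd h"
    by (rule ideal_generator[of ?S g]) (use g in \<open>auto simp: act_diff_left act_mult\<close>)
  obtain k where k: "N = d * k" using d(3)[of N] act_N by auto
  have kR: "k \<in> R" using R_quotient[of d k] R_N d k by simp
  have "degree k = 0"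
  proof (rule ccontr)
    assume "degree k \<noteq> 0"
    then obtain f where f: "f \<in> irred" "f dvd k" using ex_irred_dvd kR by blast
    then obtain w where w: "k = f * w" by auto
    have fI: "f \<in> I" using f k by (auto simp: I_def)
    have "N = f * (w * d)" using k w by (simp add: algebra_simps)
    then have "N div f = w * d" using I_nonzero[OF fI] by simp
    then have "act (N div f) x = 0" using d by (simp add: act_mult)
    then show False using x fI by blast
  qed
  moreover have "degree N = degree d + degree k"
    using k N_nonzero by (simp add: degree_mult_eq)
  ultimately have "degree d = m" by (simp add: degree_N)
  then show ?thesis using d(3)[of g] g by (auto dest: dvd_imp_degree_le)
qed

text \<open>A linear relation among the conjugates of \<open>x\<close> is an annihilating polynomial
  of degree below \<open>m\<close>. Spanning then follows by counting.\<close>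

lemma basis_if_avoiding:
  assumes x: "\<forall>f\<in>I. act (N div f) x \<noteq> 0" and cardK: "card K = Q"
  shows "is_basis_over K ((\<lambda>i. x ^ (Q ^ i)) ` {..<m})"
proof -
  let ?b = "\<lambda>i. x ^ (Q ^ i)"
  let ?B = "?b ` {..<m}"
  have indep: "c i = 0" if c: "\<And>i. i < m \<Longrightarrow> c i \<in> K" and s: "(\<Sum>i<m. c i * ?b i) = 0" and i: "i < m"
    for c :: "nat \<Rightarrow> 'a" and i
  proof -
    let ?g = "\<Sum>i<m. monom (c i) i"
    have co: "coeff ?g j = (if j < m then c j else 0)" for j
      by (simp add: coeff_sum)
    have "?g \<in> R" using c by (auto simp: R_iff co)
    moreover have "act ?g x = (\<Sum>i<m. c i * ?b i)"
    proof -
      have "act (\<Sum>i\<in>A. monom (c i) i) x = (\<Sum>i\<in>A. c i * ?b i)" if "finite A" for A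
        using that by (induction A rule: finite_induct) (auto simp: act_add_left act_monom)
      then show ?thesis by simp
    qed
    moreover have "degree ?g < m"
      using m_pos by (intro degree_lessI) (auto simp: co)
    ultimately have "?g = 0" using annihilator_degree[OF x, of ?g] s by fastforce
    then show ?thesis using co[of i] i by simp
  qed
  \<comment> \<open>The basis is a set, so repeated conjugates have to be excluded; two equal ones
    would satisfy a relation with coefficients 1 and -1.\<close>
  have inj: "inj_on ?b {..<m}"
  proof (rule inj_onI, rule ccontr)
    fix i j assume ij: "i \<in> {..<m}" "j \<in> {..<m}" "?b i = ?b j" "i \<noteq> j"
    let ?c = "\<lambda>t. if t = i then 1 else if t = j then - 1 else (0::'a)"
    have "- 1 \<in> K" by (simp add: K_def power_Q_minus)
    then have cK: "?c t \<in> K" for t by simp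
    have "(\<Sum>t<m. ?c t * ?b t) = (\<Sum>t\<in>{i, j}. ?c t * ?b t)"
      using ij by (intro sum.mono_neutral_right) auto
    then have "(\<Sum>t<m. ?c t * ?b t) = 0" using ij by simp
    from indep[of ?c i, OF cK this] ij have "?c i = 0" by simp
    then show False by simp
  qed
  have cB: "card ?B = m" using inj by (simp add: card_image)
  have indepB: "\<forall>b\<in>?B. c b = 0" if "\<forall>b\<in>?B. c b \<in> K" "(\<Sum>b\<in>?B. c b * b) = 0" for c
    using indep[of "\<lambda>i. c (?b i)"] that by (auto simp: sum.reindex[OF inj])
  let ?C = "?B \<rightarrow>\<^sub>E K"
  let ?s = "\<lambda>c. \<Sum>b\<in>?B. c b * b"
  \<comment> \<open>There are \<open>Q ^ m = CARD('a)\<close> coefficient families, made extensional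
    so that they can be counted; injectivity therefore gives surjectivity.\<close>
  have "inj_on ?s ?C"
  proof (rule inj_onI)
    fix c c' assume c: "c \<in> ?C" "c' \<in> ?C" and eq: "?s c = ?s c'"
    have "(\<Sum>b\<in>?B. (c b - c' b) * b) = 0"
      using eq by (simp add: left_diff_distrib sum_subtractf)
    moreover have "\<forall>b\<in>?B. c b - c' b \<in> K"
      using c by (auto simp: K_def power_Q_diff PiE_def Pi_def)
    ultimately have "\<forall>b\<in>?B. c b - c' b = 0" using indepB[of "\<lambda>b. c b - c' b"] by blast
    then show "c = c'" by (intro PiE_ext[OF c]) auto
  qed
  then have "card (?s ` ?C) = card ?C" by (rule card_image)
  also have "\<dots> = CARD('a)" by (simp add: card_PiE cardK cB card_UNIV)
  finally have surj: "?s ` ?C = UNIV" by (intro card_subset_eq) auto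
  have "\<exists>c. (\<forall>b\<in>?B. c b \<in> K) \<and> ?s c = y" for y
  proof -
    have "y \<in> ?s ` ?C" using surj by simp
    then show ?thesis by (auto simp: PiE_def Pi_def)
  qed
  then show ?thesis unfolding is_basis_over_def using indepB by blast
qed

section \<open>Lower bounds through the number of factors\<close>

lemma card_avoiding_ge:
  "real (card {x. \<forall>f\<in>I. act (N div f) x \<noteq> 0}) \<ge> real Q ^ m * (1 - real m / real Q)"
proof -
  have "1 - real m / real Q \<le> 1 - (\<Sum>f\<in>I. 1 / real Q ^ degree f)"
  proof -
    have "(\<Sum>f\<in>I. 1 / real Q ^ degree f) \<le> (\<Sum>f\<in>I. 1 / real Q)"
      using Q_gt_1 by (intro sum_mono divide_left_mono) (auto simp: self_le_power I_degree)
    also have "\<dots> \<le> real m / real Q"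
      using card_I_le by (simp add: divide_right_mono)
    finally show ?thesis by simp
  qed
  also have "\<dots> \<le> (\<Prod>f\<in>I. 1 - 1 / real Q ^ degree f)"
    using Q_gt_1 by (intro prod_one_minus_ge finite_I) (auto simp: divide_le_eq)
  finally show ?thesis unfolding card_avoiding by (intro mult_left_mono) auto
qed

definition linear_factors :: "'a poly set" where
  "linear_factors = {f \<in> I. degree f = 1}"

text \<open>The nonlinear factors number at most \<open>m / 2\<close>, and each costs at most
  \<open>1 / Q^2\<close>; the linear ones are kept as an exact power.\<close>

lemma card_avoiding_ge_linear_factors:
  "real (card {x. \<forall>f\<in>I. act (N div f) x \<noteq> 0})
     \<ge> real Q ^ m * ((1 - 1 / real Q) ^ card linear_factors * (1 - real m / (2 * (real Q)\<^sup>2)))"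
proof -
  let ?L = linear_factors and ?M = "I - linear_factors"
  have fin: "finite ?L" "finite ?M" using finite_I by (auto simp: linear_factors_def)
  have deg: "degree f \<ge> 2" if "f \<in> ?M" for f
    using that I_degree[of f] by (auto simp: linear_factors_def)
  have "card ?M * 2 \<le> (\<Sum>f\<in>?M. degree f)"
    using sum_bounded_below[of ?M 2 degree] deg by simp
  also have "\<dots> \<le> m" using fin by (intro sum_degree_le) auto
  finally have cM: "real (card ?M) \<le> real m / 2" by linarith
  have "(\<Sum>f\<in>?M. 1 / real Q ^ degree f) \<le> (\<Sum>f\<in>?M. 1 / (real Q)\<^sup>2)"
    using Q_gt_1 deg by (intro sum_mono divide_left_mono power_increasing) auto
  also have "\<dots> \<le> real m / (2 * (real Q)\<^sup>2)"
    using cM by (simp add: divide_simps)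
  finally have "1 - real m / (2 * (real Q)\<^sup>2) \<le> 1 - (\<Sum>f\<in>?M. 1 / real Q ^ degree f)" by simp
  also have "\<dots> \<le> (\<Prod>f\<in>?M. 1 - 1 / real Q ^ degree f)"
    using Q_gt_1 by (intro prod_one_minus_ge finite_I fin) (auto simp: divide_le_eq)
  finally have M: "1 - real m / (2 * (real Q)\<^sup>2) \<le> (\<Prod>f\<in>?M. 1 - 1 / real Q ^ degree f)" .
  have "(\<Prod>f\<in>?L. 1 - 1 / real Q ^ degree f) = (1 - 1 / real Q) ^ card ?L"
    by (simp add: linear_factors_def)
  moreover have "(\<Prod>f\<in>I. 1 - 1 / real Q ^ degree f)
      = (\<Prod>f\<in>?L. 1 - 1 / real Q ^ degree f) * (\<Prod>f\<in>?M. 1 - 1 / real Q ^ degree f)"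
    using finite_I by (subst prod.subset_diff[of ?L]) (auto simp: linear_factors_def mult.commute)
  ultimately show ?thesis
    unfolding card_avoiding using M Q_gt_1 by (auto intro!: mult_left_mono)
qed

text \<open>A monic linear factor is determined by its root, which lies in \<open>K\<close> and is a
  root of \<open>N\<close>.\<close>

lemma card_linear_factors_le:
  "card linear_factors \<le> card {c \<in> K. c \<noteq> 0 \<and> c ^ m = 1}"
proof (rule card_inj_on_le[where f = "\<lambda>f. - coeff f 0"])
  have eq: "f = [:coeff f 0, 1:]" if "f \<in> linear_factors" for f
  proof -
    have "degree f = 1" "coeff f 1 = 1"
      using that by (auto simp: linear_factors_def I_def irred_def)
    then show ?thesis
      by (intro poly_eqI) (auto simp: coeff_pCons coeff_eq_0 split: nat.splits)
  qed
  then show "inj_on (\<lambda>f. - coeff f 0) linear_factors"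
    by (intro inj_onI) (metis neg_equal_iff_equal)
  show "(\<lambda>f. - coeff f 0) ` linear_factors \<subseteq> {c \<in> K. c \<noteq> 0 \<and> c ^ m = 1}"
  proof
    fix c assume "c \<in> (\<lambda>f. - coeff f 0) ` linear_factors"
    then obtain f where f: "f \<in> linear_factors" "c = - coeff f 0" by auto
    then have fI: "f \<in> I" by (simp add: linear_factors_def)
    have "poly f c = 0" by (subst eq[OF f(1)]) (simp add: f(2))
    then have "poly N c = 0" using I_dvd[OF fI] by auto
    then have cm: "c ^ m = 1" by (simp add: N_def poly_monom)
    then have "c \<noteq> 0" using m_pos by (auto simp: power_0_left)
    moreover have "c \<in> K" using I_R[OF fI] f(2) by (simp add: R_iff K_def power_Q_minus)
    ultimately show "c \<in> {c \<in> K. c \<noteq> 0 \<and> c ^ m = 1}" using cm by simp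
  qed
qed auto

lemma card_linear_factors_le_minus_1:
  assumes "card K = Q"
  shows "card linear_factors \<le> Q - 1"
proof -
  have "card {c \<in> K. c \<noteq> 0 \<and> c ^ m = 1} \<le> card (K - {0})" by (intro card_mono) auto
  then show ?thesis using card_linear_factors_le assms by simp
qed

text \<open>The relevant roots of unity have order dividing \<open>gcd m (Q - 1)\<close>, a proper
  divisor of \<open>Q - 1\<close> and so at most half of it.\<close>

lemma card_linear_factors_le_half:
  assumes "\<not> (Q - 1) dvd m"
  shows "2 * card linear_factors \<le> Q - 1"
proof -
  let ?g = "gcd m (Q - 1)"
  have g0: "?g > 0" using m_pos by simp
  let ?P = "monom 1 ?g - 1 :: 'a poly"
  have dP: "degree ?P = ?g"
    using g0 degree_add_eq_left[of "- 1" "monom 1 ?g :: 'a poly"] by (simp add: degree_monom_eq)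
  then have P0: "?P \<noteq> 0" using g0 by auto
  have "{c \<in> K. c \<noteq> 0 \<and> c ^ m = 1} \<subseteq> {c. poly ?P c = 0}"
  proof
    fix c assume "c \<in> {c \<in> K. c \<noteq> 0 \<and> c ^ m = 1}"
    then have c: "c ^ Q = c" "c \<noteq> 0" "c ^ m = 1" by (auto simp: K_def)
    have cQ: "c ^ (Q - 1) = 1" using c Q_gt_1 power_minus_mult[of Q c] by simp
    obtain x y where "m * x = (Q - 1) * y + ?g" using bezout_nat[of m "Q - 1"] m_pos by auto
    then have "(c ^ m) ^ x = (c ^ (Q - 1)) ^ y * c ^ ?g"
      by (simp add: power_add flip: power_mult)
    then show "c \<in> {c. poly ?P c = 0}" using c cQ by (simp add: poly_monom)
  qed
  then have "card {c \<in> K. c \<noteq> 0 \<and> c ^ m = 1} \<le> card {c. poly ?P c = 0}" by (intro card_mono) auto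
  also have "\<dots> \<le> ?g" using card_poly_roots_bound[OF P0] dP by simp
  finally have "card linear_factors \<le> ?g" using card_linear_factors_le by simp
  moreover have "2 * ?g \<le> Q - 1"
  proof -
    obtain t where t: "Q - 1 = ?g * t" by (meson dvdE gcd_dvd2)
    have "t \<noteq> 1" using t assms by (metis gcd_dvd1 mult.right_neutral)
    moreover have "t \<noteq> 0" using t Q_gt_1 by (intro notI) simp
    ultimately have "t \<ge> 2" by simp
    then have "?g * 2 \<le> ?g * t" by (intro mult_le_mono2)
    then show ?thesis using t by linarith
  qed
  ultimately show ?thesis by linarith
qed

end

section \<open>From normal to completely normal elements\<close>

lemma
  fixes p k q n l :: nat
  assumes p: "CHAR('a::finite_field) = p" and k: "k > 0" and q: "q = p ^ k"
    and n: "n > 0" and card: "CARD('a) = q ^ n" and l: "l > 0" "l dvd n"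
  shows card_normal_over_ge:
      "real (card {x :: 'a. normal_over q n l x}) \<ge> real q ^ n * (1 - real n / (real l * real q ^ l))"
    and card_normal_over_ge_linear_factors: "l = 1 \<Longrightarrow>
      \<exists>a. real (card {x :: 'a. normal_over q n l x})
          \<ge> real q ^ n * ((1 - 1 / real q) ^ a * (1 - real n / (2 * (real q)\<^sup>2)))
        \<and> a \<le> q - 1 \<and> (\<not> (q - 1) dvd n \<longrightarrow> 2 * a \<le> q - 1)"
proof -
  have "prime p" using p by auto
  then have q1: "q > 1" unfolding q using k prime_gt_1_nat one_less_power by blast
  have pow: "(q ^ l) ^ (n div l) = q ^ n" using l by (simp flip: power_mult)
  interpret frobenius_module "TYPE('a)" "q ^ l" "n div l" "k * l"
  proof
    show "q ^ l = CHAR('a) ^ (k * l)" by (simp add: p q power_mult)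
    show "1 < q ^ l" using q1 l one_less_power by blast
    show "CARD('a) = (q ^ l) ^ (n div l)" by (simp add: pow card)
    show "0 < n div l" using l n by (simp add: div_greater_zero_iff dvd_imp_le)
  qed
  note sub = ex1_subfield_of_order[OF p k q n card l]
  have K: "K = subfield_of_order (q ^ l)" "card K = q ^ l"
    using sub by (auto simp: K_def)
  \<comment> \<open>One inclusion suffices for lower bounds.\<close>
  have "{x. \<forall>f\<in>I. act (N div f) x \<noteq> 0} \<subseteq> {x. normal_over q n l x}"
    using basis_if_avoiding[OF _ K(2)] by (auto simp: normal_over_def K(1) power_mult)
  then have le: "real (card {x. \<forall>f\<in>I. act (N div f) x \<noteq> 0}) \<le> real (card {x :: 'a. normal_over q n l x})"
    by (simp add: card_mono)
  have rpow: "(real q ^ l) ^ (n div l) = real q ^ n" using l by (simp flip: power_mult)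
  show "real (card {x :: 'a. normal_over q n l x}) \<ge> real q ^ n * (1 - real n / (real l * real q ^ l))"
    using order.trans[OF card_avoiding_ge le] l by (simp add: rpow real_of_nat_div)
  show "\<exists>a. real (card {x :: 'a. normal_over q n l x})
          \<ge> real q ^ n * ((1 - 1 / real q) ^ a * (1 - real n / (2 * (real q)\<^sup>2)))
        \<and> a \<le> q - 1 \<and> (\<not> (q - 1) dvd n \<longrightarrow> 2 * a \<le> q - 1)" if "l = 1"
    using order.trans[OF card_avoiding_ge_linear_factors le] card_linear_factors_le_minus_1[OF K(2)]
      card_linear_factors_le_half that
    by (intro exI[of _ "card linear_factors"]) auto
qed

text \<open>Union bound: from the elements normal for \<open>l = 1\<close>, of proportion at least
  \<open>A\<close>, remove the exceptions for each other divisor.\<close>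

lemma CN_ge:
  fixes p k q n :: nat
  assumes p: "CHAR('a::finite_field) = p" and k: "k > 0" and q: "q = p ^ k"
    and n: "n > 0" and card: "CARD('a) = q ^ n"
    and one: "real (card {x :: 'a. normal_over q n 1 x}) \<ge> real q ^ n * A"
  shows "real (CN TYPE('a) q n)
     \<ge> real q ^ n * (A - (\<Sum>l\<in>{l. l dvd n} - {1}. real n / (real l * real q ^ l)))"
proof -
  let ?D = "{l. l dvd n}" and ?E = "{l. l dvd n} - {1}"
  let ?c = "\<lambda>l. real n / (real l * real q ^ l)"
  let ?bad = "\<lambda>l. {x :: 'a. \<not> normal_over q n l x}"
  have finD: "finite ?D" using n by simp
  have bad: "real (card (?bad l)) = real q ^ n - real (card {x :: 'a. normal_over q n l x})" for l
  proof -
    have "?bad l = UNIV - {x. normal_over q n l x}" by auto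
    then show ?thesis by (simp add: card_Diff_subset card_mono flip: card)
  qed
  have "{x :: 'a. normal_over q n 1 x} \<subseteq> {x. completely_normal q n x} \<union> (\<Union>l\<in>?E. ?bad l)"
    by (auto simp: completely_normal_def)
  then have "card {x :: 'a. normal_over q n 1 x} \<le> card ({x :: 'a. completely_normal q n x} \<union> (\<Union>l\<in>?E. ?bad l))"
    by (intro card_mono) auto
  also have "\<dots> \<le> CN TYPE('a) q n + card (\<Union>l\<in>?E. ?bad l)"
    unfolding CN_def by (rule card_Un_le)
  also have "card (\<Union>l\<in>?E. ?bad l) \<le> (\<Sum>l\<in>?E. card (?bad l))"
    using finD by (intro card_UN_le) auto
  finally have "real (card {x :: 'a. normal_over q n 1 x}) \<le> real (CN TYPE('a) q n) + (\<Sum>l\<in>?E. real (card (?bad l)))"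
    by (simp flip: of_nat_sum of_nat_add)
  also have "(\<Sum>l\<in>?E. real (card (?bad l))) \<le> (\<Sum>l\<in>?E. real q ^ n * ?c l)"
  proof (rule sum_mono)
    fix l assume "l \<in> ?E"
    then have "l > 0" "l dvd n" using n by (auto intro: Nat.gr0I)
    from card_normal_over_ge[OF p k q n card this]
    show "real (card (?bad l)) \<le> real q ^ n * ?c l" unfolding bad by (simp add: algebra_simps)
  qed
  finally show ?thesis using one by (simp add: algebra_simps sum_distrib_left)
qed

section \<open>Numerical estimates\<close>

lemma sum_power_from_3_le:
  fixes x :: real
  assumes "0 \<le> x" "x < 1"
  shows "(\<Sum>l=3..n. x ^ l) \<le> x ^ 3 / (1 - x)"
proof -
  have "(\<Sum>l=3..n. x ^ l) * (1 - x) \<le> x ^ 3"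
  proof (cases "n \<ge> 3")
    case True
    then show ?thesis
      using assms sum_gp_multiplied[of 3 n x] by (simp add: mult.commute)
  qed (use assms in simp)
  then show ?thesis using assms by (simp add: divide_simps)
qed

text \<open>Replace \<open>1 / l\<close> by \<open>1 / 3\<close> and sum the geometric
  series.\<close>

lemma sum_tail_le:
  fixes q n :: nat
  assumes "q > 1" "E \<subseteq> {3..n}"
  shows "(\<Sum>l\<in>E. real n / (real l * real q ^ l)) \<le> real n / (3 * (real q)\<^sup>2 * (real q - 1))"
proof -
  have "(\<Sum>l\<in>E. real n / (real l * real q ^ l)) \<le> (\<Sum>l=3..n. real n / (real l * real q ^ l))"
    using assms by (intro sum_mono2) auto
  also have "\<dots> \<le> (\<Sum>l=3..n. real n / 3 * (1 / real q) ^ l)"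
  proof (rule sum_mono)
    fix l assume l: "l \<in> {3..n}"
    have "real n / (real l * real q ^ l) \<le> real n / (3 * real q ^ l)"
      using l assms by (intro divide_left_mono mult_right_mono mult_pos_pos) auto
    then show "real n / (real l * real q ^ l) \<le> real n / 3 * (1 / real q) ^ l"
      by (simp add: power_divide)
  qed
  also have "\<dots> = real n / 3 * (\<Sum>l=3..n. (1 / real q) ^ l)" by (simp add: sum_distrib_left)
  also have "\<dots> \<le> real n / 3 * ((1 / real q) ^ 3 / (1 - 1 / real q))"
    using assms by (intro mult_left_mono sum_power_from_3_le) auto
  also have "\<dots> = real n / (3 * (real q)\<^sup>2 * (real q - 1))"
    using assms by (simp add: divide_simps) (simp add: power2_eq_square power3_eq_cube algebra_simps)
  finally show ?thesis .
qed

text \<open>The reciprocal is \<open>(1 + 1 / (q - 1)) ^ (q - 1)\<close>, at most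
  \<open>exp 1 < 25 / 9\<close>. The constant is the square of 3/5, so that halving the exponent
  yields a rational bound.\<close>

lemma one_minus_inverse_power_ge:
  fixes q :: nat
  assumes "q > 1"
  shows "(1 - 1 / real q) ^ (q - 1) \<ge> 9 / 25"
proof -
  let ?t = "1 / (real q - 1)"
  have "(1 + ?t) ^ (q - 1) \<le> exp ?t ^ (q - 1)"
    using assms by (intro power_mono exp_ge_add_one_self) auto
  also have "\<dots> = exp 1" using assms by (simp add: of_nat_diff flip: exp_of_nat_mult)
  also have "\<dots> \<le> 25 / 9" using e_less_272 by simp
  finally have le: "(1 + ?t) ^ (q - 1) \<le> 25 / 9" .
  have "1 - 1 / real q = 1 / (1 + ?t)" using assms by (simp add: divide_simps)
  then have "(1 - 1 / real q) ^ (q - 1) = 1 / (1 + ?t) ^ (q - 1)" by (simp add: power_divide)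
  moreover have "(1 + ?t) ^ (q - 1) > 0" using assms by (intro zero_less_power) (simp add: add_pos_pos)
  ultimately show ?thesis using le divide_left_mono[OF le, of 1] by simp
qed

theorem theorem5:
  fixes p k q n :: nat
  assumes "CHAR('a::finite_field) = p" and "k > 0" and "q = p ^ k"
    and "n > 0" and "CARD('a) = q ^ n"
  shows "(odd n \<and> q \<ge> 8 \<longrightarrow>
           real (CN TYPE('a) q n) \<ge>
             real q ^ n * (2 / (real q + 1) - 1.45 * real n / ((real q)\<^sup>2 * (real q + 1)))) \<and>
         (even n \<and> q \<ge> 9 \<and> \<not> (q - 1) dvd n \<longrightarrow>
           real (CN TYPE('a) q n) \<ge>
             real q ^ n * (1 / 2 + 1 / (real q + 1) - 0.86 * real n / (real q)\<^sup>2))"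
proof -
  let ?c = "\<lambda>l. real n / (real l * real q ^ l)"
  let ?E = "{l. l dvd n} - {1}"
  let ?u = "1 - real n / (2 * (real q)\<^sup>2)"
  let ?r = "real n / (real q)\<^sup>2"
  have r0: "?r \<ge> 0" by simp
  have u: "?u = 1 - ?r / 2" by simp
  obtain a where normal: "real (card {x :: 'a. normal_over q n 1 x}) \<ge> real q ^ n * ((1 - 1 / real q) ^ a * ?u)"
    and a1: "a \<le> q - 1" and a2: "\<not> (q - 1) dvd n \<Longrightarrow> 2 * a \<le> q - 1"
    using card_normal_over_ge_linear_factors[OF assms, of 1] by auto
  note CN = CN_ge[OF assms normal]
  have tail: "real n / (3 * (real q)\<^sup>2 * (real q - 1)) = ?r / (3 * (real q - 1))" by simp
  have sqpow: "(1 - 1 / real q) ^ i \<ge> 9 / 25" if "i \<le> q - 1" "q > 1" for i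
  proof -
    have "9 / 25 \<le> (1 - 1 / real q) ^ (q - 1)" using that by (intro one_minus_inverse_power_ge) auto
    also have "\<dots> \<le> (1 - 1 / real q) ^ i" using that by (intro power_decreasing) auto
    finally show ?thesis .
  qed
  show ?thesis
  proof (intro conjI impI)
    assume *: "odd n \<and> q \<ge> 8"
    then have q8: "real q \<ge> 8" by simp
    let ?B = "2 / (real q + 1) - 1.45 * real n / ((real q)\<^sup>2 * (real q + 1))"
    have B: "?B = 2 / (real q + 1) - 1.45 * ?r / (real q + 1)" by simp
    show "real (CN TYPE('a) q n) \<ge> real q ^ n * ?B"
    \<comment> \<open>For \<open>?r > 2\<close> the claimed bound is negative; otherwise
      \<open>?u\<close> is nonnegative and may multiply inequalities.\<close>
    proof (cases "?r \<le> 2")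
      case False
      then have "?B \<le> 0" unfolding B using q8 by (simp add: divide_simps)
      then have "real q ^ n * ?B \<le> 0" by (intro mult_nonneg_nonpos) auto
      then show ?thesis by linarith
    next
      case True
      have "?E \<subseteq> {3..n}"
      proof
        fix l assume l: "l \<in> ?E"
        then have "l \<noteq> 0" "l \<noteq> 2" "l \<noteq> 1" "l \<le> n" using * assms(4) by (auto dest: dvd_imp_le)
        then show "l \<in> {3..n}" by simp
      qed
      then have "(\<Sum>l\<in>?E. ?c l) \<le> ?r / (3 * (real q - 1))"
        using sum_tail_le[of q ?E n] * unfolding tail by simp
      also have "\<dots> \<le> 0.45 * ?r / (real q + 1)"
      \<comment> \<open>This needs \<open>q + 1 \<le> 1.35 (q - 1)\<close>, true from
        \<open>q = 8\<close> on. The constant 1.45 is 0.45 from this tail plus 1 from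
        \<open>2 / (q + 1) * ?u\<close>.\<close>
      proof -
        have "t / (3 * (real q - 1)) \<le> 0.45 * t / (real q + 1)" if "t \<ge> 0" for t
        proof -
          have "1 / (3 * (real q - 1)) \<le> 0.45 / (real q + 1)" using q8 by (simp add: divide_simps)
          from mult_left_mono[OF this that] show ?thesis by (simp add: mult.commute)
        qed
        then show ?thesis using r0 by blast
      qed
      finally have s: "(\<Sum>l\<in>?E. ?c l) \<le> 0.45 * ?r / (real q + 1)" .
      have "2 / (real q + 1) \<le> 9 / 25" using q8 by (simp add: divide_simps)
      also have "\<dots> \<le> (1 - 1 / real q) ^ a" using * a1 by (intro sqpow) auto
      finally have "2 / (real q + 1) * ?u \<le> (1 - 1 / real q) ^ a * ?u"
        using True unfolding u by (intro mult_right_mono) auto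
      moreover have "2 / (real q + 1) * ?u = 2 / (real q + 1) - ?r / (real q + 1)"
        unfolding u by (simp add: right_diff_distrib)
      moreover have "?B = 2 / (real q + 1) - ?r / (real q + 1) - 0.45 * ?r / (real q + 1)"
        unfolding B by (simp add: diff_divide_distrib[symmetric])
      ultimately have "?B \<le> (1 - 1 / real q) ^ a * ?u - (\<Sum>l\<in>?E. ?c l)" using s by linarith
      then have "real q ^ n * ?B \<le> real q ^ n * ((1 - 1 / real q) ^ a * ?u - (\<Sum>l\<in>?E. ?c l))"
        by (intro mult_left_mono) auto
      then show ?thesis using CN by linarith
    qed
  next
    assume *: "even n \<and> q \<ge> 9 \<and> \<not> (q - 1) dvd n"
    then have q9: "real q \<ge> 9" by simp
    let ?B = "1 / 2 + 1 / (real q + 1) - 0.86 * real n / (real q)\<^sup>2"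
    have B: "?B = 1 / 2 + 1 / (real q + 1) - 43 / 50 * ?r" by simp
    \<comment> \<open>Equality holds at \<open>q = 9\<close>.\<close>
    have C: "1 / 2 + 1 / (real q + 1) \<le> 3 / 5" using q9 by (simp add: divide_simps)
    show "real (CN TYPE('a) q n) \<ge> real q ^ n * ?B"
    proof (cases "?r \<le> 2")
      case False
      then have "?B \<le> 0" unfolding B using C by linarith
      then have "real q ^ n * ?B \<le> 0" by (intro mult_nonneg_nonpos) auto
      then show ?thesis by linarith
    next
      case True
      have sub: "?E - {2} \<subseteq> {3..n}"
      proof
        fix l assume l: "l \<in> ?E - {2}"
        then have "l \<noteq> 0" "l \<noteq> 2" "l \<noteq> 1" "l \<le> n" using assms(4) by (auto dest: dvd_imp_le)
        then show "l \<in> {3..n}" by simp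
      qed
      \<comment> \<open>The divisor 2 alone costs \<open>?r / 2\<close>, so it is kept apart from
        the tail.\<close>
      have "(\<Sum>l\<in>?E. ?c l) = ?c 2 + (\<Sum>l\<in>?E - {2}. ?c l)"
        using * assms(4) by (intro sum.remove) auto
      also have "(\<Sum>l\<in>?E - {2}. ?c l) \<le> ?r / (3 * (real q - 1))"
      proof -
        have "q > 1" using * by simp
        from sum_tail_le[OF this sub] show ?thesis unfolding tail .
      qed
      also have "\<dots> \<le> ?r / 24"
        using q9 r0 by (intro divide_left_mono) auto
      also have "?c 2 = ?r / 2" by simp
      finally have s: "(\<Sum>l\<in>?E. ?c l) \<le> ?r / 2 + ?r / 24" by simp
      \<comment> \<open>Squaring doubles the exponent, and \<open>2 * a \<le> q - 1\<close> because
        \<open>q - 1\<close> does not divide \<open>n\<close>.\<close>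
      have "(3 / 5)\<^sup>2 \<le> ((1 - 1 / real q) ^ a)\<^sup>2"
        using sqpow[of "2 * a"] a2 * by (simp add: power_divide mult.commute[of 2 a] flip: power_mult)
      then have "3 / 5 \<le> (1 - 1 / real q) ^ a"
        using q9 by (intro power2_le_imp_le[of "3 / 5"]) auto
      then have "3 / 5 * ?u \<le> (1 - 1 / real q) ^ a * ?u"
        using True unfolding u by (intro mult_right_mono) auto
      then have "?B \<le> (1 - 1 / real q) ^ a * ?u - (\<Sum>l\<in>?E. ?c l)"
      proof -
        \<comment> \<open>The losses in \<open>t\<close> add up to 3/10 + 1/2 + 1/24 = 101/120,
          which is below 43/50.\<close>
        have "v - 43 / 50 * t \<le> y - z"
          if "3 / 5 * (1 - t / 2) \<le> y" "z \<le> t / 2 + t / 24" "v \<le> 3 / 5" "0 \<le> t" for t v y z :: real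
          using that by argo
        from this[OF _ s C r0] show ?thesis
          using \<open>3 / 5 * ?u \<le> (1 - 1 / real q) ^ a * ?u\<close> unfolding B u by blast
      qed
      then have "real q ^ n * ?B \<le> real q ^ n * ((1 - 1 / real q) ^ a * ?u - (\<Sum>l\<in>?E. ?c l))"
        by (intro mult_left_mono) auto
      then show ?thesis using CN by linarith
    qed
  qed
qed

end
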